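(* Let $n \ge 1$, let $\sigma \in \mathfrak{S}_n$, and let $R = R(\sigma)$ be the pile configuration formed from $\sigma$ under Patience Sorting. Then $\sigma$ is the unique preimage of $R$ under Patience Sorting (i.e., $\sigma$ is the only permutation $\tau \in \mathfrak{S}_n$ with $R(\tau) = R$) if and only if $\sigma \in S_n(3\textrm{-}\bar{1}\textrm{-}42,\ 3\textrm{-}\bar{1}\textrm{-}24)$.
   Context: $\mathfrak{S}_n$ is the set of permutations of $\{1,\dots,n\}$ written in one-line notation $\sigma=\sigma_1\sigma_2\cdots\sigma_n$. Patience Sorting: given $\sigma = c_1c_2\cdots c_n\in\mathfrak{S}_n$, form an ordered list of piles $R(\sigma)=\{r_1,r_2,\dots,r_m\}$ (the pile configuration of $\sigma$) as follows. Place $c_1$ into a pile $r_1$ by itself. For $i=2,\dots,n$ in turn, let $d_1,\dots,d_k$ be the cards atop the piles $r_1,\dots,r_k$ already formed. If $c_i>\max\{d_1,\dots,d_k\}$, put $c_i$ into a new right-most pile $r_{k+1}$ by itself; otherwise find the left-most card $d_j$ that is larger than $c_i$ and put $c_i$ atop pile $r_j$. Two pile configurations are equal if they have the same piles in the same left-to-right order with the same cards in the same order. Barred (generalized) patterns: in a generalized pattern, letters not separated by a dash must be matched by entries in adjacent positions of $\sigma$, while letters separated by a dash need not be adjacent. A permutation $\sigma$ avoids a barred pattern if every occurrence in $\sigma$ of the pattern formed by the unbarred letters is part of an occurrence of the full pattern (with the bar removed). Explicitly: (i) $\sigma$ avoids $3\textrm{-}\bar{1}\textrm{-}42$ if for all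 positions $i<j<j+1\le n$ with $\sigma_{j+1}<\sigma_i<\sigma_j$ there is $p$ with $i<p<j$ and $\sigma_p<\sigma_{j+1}$; (ii) $\sigma$ avoids $3\textrm{-}\bar{1}\textrm{-}24$ if for all positions $i<j<j+1\le n$ with $\sigma_{j}<\sigma_i<\sigma_{j+1}$ there is $p$ with $i<p<j$ and $\sigma_p<\sigma_{j}$. $S_n(\beta^{(1)},\dots,\beta^{(k)})$ denotes the set of $\sigma\in\mathfrak{S}_n$ that avoid all of $\beta^{(1)},\dots,\beta^{(k)}$ simultaneously. *)

theory Defs
  imports "HOL-Combinatorics.Multiset_Permutations"
begin

text \<open>
  A permutation of \<open>{1..n}\<close> in one-line notation is an element of
  \<open>permutations_of_set {1..n}\<close>, that is, a duplicate-free list whose set of entries is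
  \<open>{1..n}\<close>.  List positions count from 0, so the entry at position \<open>i\<close> of the mathematical
  text is \<open>\<sigma> ! (i - 1)\<close>.

  A pile is the list of its cards from top to bottom, so \<open>hd r\<close> is the card atop \<open>r\<close>.  A pile
  configuration is the list of its piles from left to right.
\<close>

text \<open>The empty configuration falls under the first case, so the first card starts the first pile.\<close>

definition place_card :: "nat \<Rightarrow> nat list list \<Rightarrow> nat list list" where
  "place_card c rs =
     (if \<forall>r\<in>set rs. hd r < c then rs @ [[c]]
      else let j = (LEAST j. j < length rs \<and> c < hd (rs ! j)) in rs[j := c # rs ! j])"

definition pile_configuration :: "nat list \<Rightarrow> nat list list" where
  "pile_configuration \<sigma> = fold place_card \<sigma> []"

text \<open>
  Barred patterns.  In the names, \<open>b1\<close> is the barred letter 1.  The letters after the last dash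
  sit at the adjacent positions \<open>j\<close> and \<open>Suc j\<close>; every occurrence of the unbarred letters
  (\<open>3-42\<close>, respectively \<open>3-24\<close>) must extend by some position \<open>p\<close> carrying the letter 1.
\<close>

definition avoids_3_b1_42 :: "nat list \<Rightarrow> bool" where
  "avoids_3_b1_42 \<sigma> \<longleftrightarrow>
     (\<forall>i j. i < j \<and> Suc j < length \<sigma> \<and> \<sigma> ! Suc j < \<sigma> ! i \<and> \<sigma> ! i < \<sigma> ! j \<longrightarrow>
        (\<exists>p. i < p \<and> p < j \<and> \<sigma> ! p < \<sigma> ! Suc j))"

definition avoids_3_b1_24 :: "nat list \<Rightarrow> bool" where
  "avoids_3_b1_24 \<sigma> \<longleftrightarrow>
     (\<forall>i j. i < j \<and> Suc j < length \<sigma> \<and> \<sigma> ! j < \<sigma> ! i \<and> \<sigma> ! i < \<sigma> ! Suc j \<longrightarrow>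
        (\<exists>p. i < p \<and> p < j \<and> \<sigma> ! p < \<sigma> ! j))"

text \<open>The set \<open>S\<^sub>n(\<beta>\<^sup>1, \<dots>, \<beta>\<^sup>k)\<close>; each pattern is given by its avoidance predicate.\<close>

definition avoiders :: "nat \<Rightarrow> (nat list \<Rightarrow> bool) list \<Rightarrow> nat list set" where
  "avoiders n \<beta>s = {\<sigma> \<in> permutations_of_set {1..n}. \<forall>avoids\<in>set \<beta>s. avoids \<sigma>}"

end

theory Submission
  imports Defs
begin

text \<open>
  Everything is read off the number \<open>slot c rs\<close> of the pile that a card \<open>c\<close> would join if it were
  dealt next onto the piles \<open>rs\<close>.  Slots grow with the card (\<open>slot_mono\<close>) and with time
  (\<open>slot_le_slot_place_card\<close>); dealing \<open>x\<close> pushes every larger card to the right of \<open>x\<close>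
  (\<open>slot_less_slot_place_card\<close>) and moves no smaller card (\<open>slot_place_card_larger\<close>).

  Call an adjacent pair of \<open>\<sigma>\<close> independent if, just before it is dealt, its two cards have
  different slots.  Then exchanging the pair does not change the pile configuration.  Conversely,
  suppose that \<open>\<tau> \<noteq> \<sigma>\<close> has the same configuration, and let \<open>b\<close> be the first card of \<open>\<tau>\<close> that
  differs from the card of \<open>\<sigma>\<close> in the same position.  Both permutations lay \<open>b\<close> on the same
  cards of the same pile, so in \<open>\<sigma>\<close> the slot of \<open>b\<close> is constant from the end of the common prefix
  until \<open>b\<close> is dealt, and the card dealt just before \<open>b\<close> goes to another pile; this is an
  independent pair.  So \<open>\<sigma>\<close> is the only preimage of its configuration exactly if it has no
  independent pair (\<open>pile_configuration_swap\<close>, \<open>independent_pair_exists\<close>).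

  It remains to compare independent pairs with occurrences of the two patterns.  Together, the
  patterns forbid an entry whose value lies strictly between those of a later adjacent pair while
  no entry from it to the pair is smaller than both.  Such an entry forces the slots of the
  pair apart (\<open>pattern_independent\<close>).  In the other direction an independent pair need not be such an
  occurrence, but the leftmost one is (\<open>first_independent_pattern\<close>): the card that separates the
  two slots is the entry in question, and a smaller card after it would make an earlier pair
  independent.
\<close>

section \<open>The slot of a card\<close>

definition slot :: "nat \<Rightarrow> nat list list \<Rightarrow> nat" where
  "slot c rs = length (takeWhile (\<lambda>r. hd r < c) rs)"

lemma slot_Nil [simp]: "slot c [] = 0"
  and slot_Cons [simp]: "slot c (r # rs) = (if hd r < c then Suc (slot c rs) else 0)"
  by (simp_all add: slot_def)

lemma slot_le_of_top: "k < length rs \<Longrightarrow> \<not> hd (rs ! k) < c \<Longrightarrow> slot c rs \<le> k"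
  by (metis not_le nth_mem set_takeWhileD slot_def takeWhile_nth)

lemma top_less_of_less_slot: "k < slot c rs \<Longrightarrow> k < length rs \<and> hd (rs ! k) < c"
  unfolding slot_def
  by (metis length_takeWhile_le less_le_trans nth_mem set_takeWhileD takeWhile_nth)

lemma top_at_slot: "slot c rs < length rs \<Longrightarrow> \<not> hd (rs ! slot c rs) < c"
  unfolding slot_def by (rule nth_length_takeWhile)

text \<open>
  A card that equals the top of a pile is outside the scope of the dealing rule, whence the
  premise of this lemma and of its consequences.
\<close>

lemma place_card_slot:
  assumes "c \<notin> hd ` set rs"
  shows "place_card c rs =
    (if slot c rs < length rs then rs[slot c rs := c # rs ! slot c rs] else rs @ [[c]])"
proof (cases "\<forall>r\<in>set rs. hd r < c")
  case True
  then have "slot c rs = length rs"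
    by (simp add: slot_def takeWhile_eq_all_conv[THEN iffD2])
  with True show ?thesis
    by (simp add: place_card_def)
next
  case False
  then have lt: "slot c rs < length rs"
    unfolding slot_def by (metis takeWhile_eq_all_conv length_takeWhile_le
        takeWhile_eq_take take_all le_neq_implies_less order_refl)
  have "hd (rs ! slot c rs) \<noteq> c"
    using lt assms by (metis image_eqI nth_mem)
  with top_at_slot[OF lt] have "c < hd (rs ! slot c rs)"
    by simp
  moreover have "slot c rs \<le> j" if "j < length rs \<and> c < hd (rs ! j)" for j
    using that by (intro slot_le_of_top) auto
  ultimately have "(LEAST j. j < length rs \<and> c < hd (rs ! j)) = slot c rs"
    using lt by (intro Least_equality) auto
  then show ?thesis
    unfolding place_card_def Let_def if_not_P[OF False] using lt by simp
qed

lemma place_card_Nil [simp]: "place_card c [] = [[c]]"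
  by (simp add: place_card_def)

lemma place_card_Cons:
  assumes "c \<notin> hd ` set (r # rs)"
  shows "place_card c (r # rs) = (if hd r < c then r # place_card c rs else (c # r) # rs)"
  using assms by (simp add: place_card_slot)

lemma slot_le_length: "slot c rs \<le> length rs"
  by (simp add: slot_def length_takeWhile_le)

lemma place_card_at_slot:
  assumes "c \<notin> hd ` set rs"
  shows "slot c rs < length (place_card c rs)"
    and "place_card c rs ! slot c rs =
      c # (if slot c rs < length rs then rs ! slot c rs else [])"
  using slot_le_length[of c rs] by (auto simp: place_card_slot[OF assms] nth_append)

lemma slot_mono: "c \<le> d \<Longrightarrow> slot c rs \<le> slot d rs"
  by (induction rs) auto

lemma slot_le_slot_place_card:
  "x \<notin> hd ` set rs \<Longrightarrow> slot c rs \<le> slot c (place_card x rs)"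
  by (induction rs) (auto simp: place_card_Cons)

lemma slot_less_slot_place_card:
  "x \<notin> hd ` set rs \<Longrightarrow> x < c \<Longrightarrow> slot x rs < slot c (place_card x rs)"
  by (induction rs) (auto simp: place_card_Cons)

lemma slot_place_card_larger:
  "x \<notin> hd ` set rs \<Longrightarrow> c < x \<Longrightarrow> slot c (place_card x rs) = slot c rs"
  by (induction rs) (auto simp: place_card_Cons)

lemma hd_place_card:
  "x \<notin> hd ` set rs \<Longrightarrow> hd ` set (place_card x rs) \<subseteq> insert x (hd ` set rs)"
  by (induction rs) (auto simp: place_card_Cons)

text \<open>
  The slot of the larger card is then further right.  It does not change when the smaller card
  lowers the top of a pile to its left, and the larger card never moves the slot of the smaller.
\<close>

lemma place_card_commute:
  assumes "slot a rs \<noteq> slot b rs" "a \<noteq> b" "a \<notin> hd ` set rs" "b \<notin> hd ` set rs"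
  shows "place_card a (place_card b rs) = place_card b (place_card a rs)"
  using assms
proof (induction rs)
  case (Cons r rs)
  have "a \<notin> hd ` set (place_card b rs)" "b \<notin> hd ` set (place_card a rs)"
    using Cons.prems hd_place_card[of b rs] hd_place_card[of a rs] by auto
  with Cons show ?case
    by (auto simp: place_card_Cons split: if_splits)
qed simp

section \<open>Recovering the moment of dealing from the final configuration\<close>

text \<open>
  The number of the pile that holds \<open>c\<close>, and the cards beneath \<open>c\<close>.  Later cards go atop the piles
  or to the right of them, so both are fixed when \<open>c\<close> is dealt.
\<close>

fun location :: "nat \<Rightarrow> nat list list \<Rightarrow> nat \<times> nat list" where
  "location c [] = (0, [])"
| "location c (r # rs) =
     (if c \<in> set r then (0, tl (dropWhile (\<lambda>x. x \<noteq> c) r)) else apfst Suc (location c rs))"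

lemma location_place_card_other:
  "x \<notin> hd ` set rs \<Longrightarrow> c \<noteq> x \<Longrightarrow> c \<in> \<Union> (set ` set rs) \<Longrightarrow>
   location c (place_card x rs) = location c rs"
  by (induction rs) (force simp: place_card_Cons)+

lemma location_place_card_self:
  "c \<notin> hd ` set rs \<Longrightarrow> c \<notin> \<Union> (set ` set rs) \<Longrightarrow>
   location c (place_card c rs) =
     (slot c rs, if slot c rs < length rs then rs ! slot c rs else [])"
  by (induction rs) (auto simp: place_card_Cons)

lemma set_place_card:
  "c \<notin> hd ` set rs \<Longrightarrow> \<Union> (set ` set (place_card c rs)) = insert c (\<Union> (set ` set rs))"
  by (induction rs) (auto simp: place_card_Cons)

lemma pile_configuration_Nil [simp]: "pile_configuration [] = []"
  by (simp add: pile_configuration_def)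

lemma pile_configuration_snoc [simp]:
  "pile_configuration (xs @ [c]) = place_card c (pile_configuration xs)"
  by (simp add: pile_configuration_def)

lemma hd_pile_configuration:
  "distinct xs \<Longrightarrow> hd ` set (pile_configuration xs) \<subseteq> set xs"
proof (induction xs rule: rev_induct)
  case (snoc c xs)
  then show ?case
    using hd_place_card[of c "pile_configuration xs"] by auto
qed simp

lemma not_hd_pile_configuration:
  "distinct xs \<Longrightarrow> c \<notin> set xs \<Longrightarrow> c \<notin> hd ` set (pile_configuration xs)"
  using hd_pile_configuration by blast

lemma set_pile_configuration:
  "distinct xs \<Longrightarrow> \<Union> (set ` set (pile_configuration xs)) = set xs"
proof (induction xs rule: rev_induct)
  case (snoc c xs)
  then show ?case
    using set_place_card[of c "pile_configuration xs"] not_hd_pile_configuration[of xs c] by auto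
qed simp

lemma location_pile_configuration:
  assumes "distinct (xs @ c # ys)"
  defines "k \<equiv> slot c (pile_configuration xs)"
  shows "location c (pile_configuration (xs @ c # ys)) =
    (k, if k < length (pile_configuration xs) then pile_configuration xs ! k else [])"
  using assms(1)
proof (induction ys rule: rev_induct)
  case Nil
  then show ?case
    using location_place_card_self[of c "pile_configuration xs"]
      not_hd_pile_configuration[of xs c] set_pile_configuration[of xs] by (simp add: k_def)
next
  case (snoc y ys)
  let ?zs = "xs @ c # ys"
  have "location c (place_card y (pile_configuration ?zs)) = location c (pile_configuration ?zs)"
    using snoc.prems not_hd_pile_configuration[of ?zs y] set_pile_configuration[of ?zs]
    by (intro location_place_card_other) auto
  then show ?case
    using snoc pile_configuration_snoc[of ?zs y] by auto
qed

lemma slot_append_mono: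
  "distinct (xs @ ys) \<Longrightarrow>
   slot c (pile_configuration xs) \<le> slot c (pile_configuration (xs @ ys))"
proof (induction ys rule: rev_induct)
  case (snoc y ys)
  have "slot c (pile_configuration (xs @ ys)) \<le> slot c (pile_configuration ((xs @ ys) @ [y]))"
    using snoc.prems not_hd_pile_configuration[of "xs @ ys" y]
    by (simp del: append_assoc add: slot_le_slot_place_card)
  with snoc show ?case
    by simp
qed simp

lemma slot_append_larger:
  "distinct (xs @ ys) \<Longrightarrow> \<forall>y\<in>set ys. c < y \<Longrightarrow>
   slot c (pile_configuration (xs @ ys)) = slot c (pile_configuration xs)"
proof (induction ys rule: rev_induct)
  case (snoc y ys)
  have "slot c (pile_configuration ((xs @ ys) @ [y])) = slot c (pile_configuration (xs @ ys))"
    using snoc.prems not_hd_pile_configuration[of "xs @ ys" y]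
    by (simp del: append_assoc add: slot_place_card_larger)
  with snoc show ?case
    by simp
qed simp

section \<open>Independent adjacent pairs\<close>

definition independent_pair :: "nat list \<Rightarrow> nat \<Rightarrow> bool" where
  "independent_pair \<sigma> j \<longleftrightarrow> Suc j < length \<sigma> \<and>
     slot (\<sigma> ! j) (pile_configuration (take j \<sigma>)) \<noteq>
     slot (\<sigma> ! Suc j) (pile_configuration (take j \<sigma>))"

lemma pile_configuration_swap:
  assumes "distinct (xs @ a # b # ys)"
    and "slot a (pile_configuration xs) \<noteq> slot b (pile_configuration xs)"
  shows "pile_configuration (xs @ b # a # ys) = pile_configuration (xs @ a # b # ys)"
proof -
  have "place_card a (place_card b (pile_configuration xs)) =
        place_card b (place_card a (pile_configuration xs))"
    using assms not_hd_pile_configuration[of xs] by (intro place_card_commute) auto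
  then show ?thesis
    by (simp add: pile_configuration_def)
qed

lemma independent_pair_exists:
  assumes "distinct \<sigma>" "distinct \<tau>" "set \<tau> = set \<sigma>" "\<tau> \<noteq> \<sigma>"
    and same: "pile_configuration \<tau> = pile_configuration \<sigma>"
  obtains j where "independent_pair \<sigma> j"
proof -
  have "length \<sigma> = length \<tau>"
    using assms(1-3) by (metis distinct_card)
  then obtain xs a as b bs where "a \<noteq> b"
    and \<sigma>: "\<sigma> = xs @ a # as" and \<tau>: "\<tau> = xs @ b # bs"
    using same_length_different[of \<sigma> \<tau>] \<open>\<tau> \<noteq> \<sigma>\<close> by (metis append_Cons append_Nil)
  have "b \<in> set as"
    using assms(1-3) \<open>a \<noteq> b\<close> unfolding \<sigma> \<tau> by auto
  then obtain us ys where "as = us @ b # ys"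
    by (meson split_list)
  moreover obtain vs c where "a # us = vs @ [c]"
    by (metis list.distinct(1) rev_exhaust)
  ultimately have \<sigma>': "\<sigma> = (xs @ vs @ [c]) @ b # ys"
    using \<sigma> by simp
  let ?before = "pile_configuration (xs @ vs)"
  let ?after = "pile_configuration (xs @ vs @ [c])"
  let ?pile = "\<lambda>k rs. if k < length rs then rs ! k else []"
  \<comment> \<open>Both permutations lay \<open>b\<close> on the same cards of the same pile.\<close>
  have "location b (pile_configuration \<sigma>) = (slot b ?after, ?pile (slot b ?after) ?after)"
    using location_pile_configuration[of "xs @ vs @ [c]" b ys] assms(1) \<sigma>' by simp
  moreover have "location b (pile_configuration \<tau>) = (slot b (pile_configuration xs),
      ?pile (slot b (pile_configuration xs)) (pile_configuration xs))"
    using location_pile_configuration[of xs b bs] assms(2) \<tau> by simp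
  ultimately have slots: "slot b ?after = slot b (pile_configuration xs)"
    and piles: "?pile (slot b ?after) ?after =
      ?pile (slot b (pile_configuration xs)) (pile_configuration xs)"
    using same by auto
  have "slot b (pile_configuration xs) \<le> slot b ?before" "slot b ?before \<le> slot b ?after"
    using assms(1) \<sigma>' slot_append_mono[of xs vs b] slot_append_mono[of "xs @ vs" "[c]" b] by auto
  with slots have stable: "slot b ?before = slot b ?after"
    by simp
  have "slot c ?before \<noteq> slot b ?before"
  proof
    assume eq: "slot c ?before = slot b ?before"
    have "?after = place_card c ?before"
      using pile_configuration_snoc[of "xs @ vs" c] by simp
    moreover have "c \<notin> hd ` set ?before"
      using assms(1) \<sigma>' not_hd_pile_configuration[of "xs @ vs" c] by auto
    ultimately have "c \<in> set (?pile (slot c ?before) ?after)"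
      by (simp add: place_card_at_slot)
    then have "c \<in> set (?pile (slot b ?after) ?after)"
      by (simp only: eq stable)
    \<comment> \<open>The card \<open>c\<close> would lie beneath \<open>b\<close> and so would belong to the common prefix.\<close>
    then have "c \<in> \<Union> (set ` set (pile_configuration xs))"
      unfolding piles by (auto split: if_splits)
    then show False
      using assms(1) \<sigma>' set_pile_configuration[of xs] by auto
  qed
  then have "independent_pair \<sigma> (length (xs @ vs))"
    unfolding independent_pair_def \<sigma>' by (simp add: nth_append)
  then show thesis
    by (rule that)
qed

section \<open>Independent pairs and the two patterns\<close>

text \<open>
  The two patterns differ only in the order of the adjacent letters, so \<open>min\<close> and \<open>max\<close> of the
  adjacent pair treat them as one.
\<close>

definition unguarded :: "nat list \<Rightarrow> nat \<Rightarrow> nat \<Rightarrow> bool" where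
  "unguarded \<sigma> i j \<longleftrightarrow> i < j \<and> Suc j < length \<sigma> \<and>
     min (\<sigma> ! j) (\<sigma> ! Suc j) < \<sigma> ! i \<and> \<sigma> ! i < max (\<sigma> ! j) (\<sigma> ! Suc j) \<and>
     (\<forall>p. i < p \<and> p < j \<longrightarrow> min (\<sigma> ! j) (\<sigma> ! Suc j) \<le> \<sigma> ! p)"

lemma avoids_iff_not_unguarded:
  "avoids_3_b1_42 \<sigma> \<and> avoids_3_b1_24 \<sigma> \<longleftrightarrow> (\<forall>i j. \<not> unguarded \<sigma> i j)"
proof
  assume "avoids_3_b1_42 \<sigma> \<and> avoids_3_b1_24 \<sigma>"
  then show "\<forall>i j. \<not> unguarded \<sigma> i j"
    unfolding avoids_3_b1_42_def avoids_3_b1_24_def unguarded_def min_def max_def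
    by (smt (verit) not_le)
next
  assume none: "\<forall>i j. \<not> unguarded \<sigma> i j"
  have "\<exists>p. i < p \<and> p < j \<and> \<sigma> ! p < \<sigma> ! Suc j"
    if "i < j" "Suc j < length \<sigma>" "\<sigma> ! Suc j < \<sigma> ! i" "\<sigma> ! i < \<sigma> ! j" for i j
    using none[rule_format, of i j] that by (auto simp: unguarded_def not_le)
  moreover have "\<exists>p. i < p \<and> p < j \<and> \<sigma> ! p < \<sigma> ! j"
    if "i < j" "Suc j < length \<sigma>" "\<sigma> ! j < \<sigma> ! i" "\<sigma> ! i < \<sigma> ! Suc j" for i j
    using none[rule_format, of i j] that by (auto simp: unguarded_def not_le)
  ultimately show "avoids_3_b1_42 \<sigma> \<and> avoids_3_b1_24 \<sigma>"
    unfolding avoids_3_b1_42_def avoids_3_b1_24_def by blast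
qed

lemma not_hd_pile_configuration_take:
  "distinct \<sigma> \<Longrightarrow> j \<le> m \<Longrightarrow> m < length \<sigma> \<Longrightarrow>
   \<sigma> ! m \<notin> hd ` set (pile_configuration (take j \<sigma>))"
  by (intro not_hd_pile_configuration) (auto simp: in_set_conv_nth nth_eq_iff_index_eq)

lemma pile_configuration_take_Suc:
  "j < length \<sigma> \<Longrightarrow> pile_configuration (take (Suc j) \<sigma>) =
     place_card (\<sigma> ! j) (pile_configuration (take j \<sigma>))"
  by (simp add: take_Suc_conv_app_nth)

lemma slot_take_mono:
  assumes "distinct \<sigma>" "i \<le> j"
  shows "slot c (pile_configuration (take i \<sigma>)) \<le> slot c (pile_configuration (take j \<sigma>))"
proof -
  have "take j \<sigma> = take i \<sigma> @ drop i (take j \<sigma>)"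
    using \<open>i \<le> j\<close> by (metis append_take_drop_id min.absorb1 take_take)
  with assms(1) show ?thesis
    using slot_append_mono[of "take i \<sigma>" "drop i (take j \<sigma>)" c] by (metis distinct_take)
qed

text \<open>
  The larger card of the pair is pushed past the card at \<open>i\<close>.  The smaller one is not moved from
  \<open>i\<close> on, because all cards in between are larger, so it keeps a slot no further right than that
  of the card at \<open>i\<close>.
\<close>

lemma pattern_independent:
  assumes "distinct \<sigma>" "unguarded \<sigma> i j"
  shows "independent_pair \<sigma> j"
proof -
  define lo hi where "lo = min (\<sigma> ! j) (\<sigma> ! Suc j)" and "hi = max (\<sigma> ! j) (\<sigma> ! Suc j)"
  let ?s = "\<lambda>c t. slot c (pile_configuration (take t \<sigma>))"
  have ij: "i < j" "Suc j < length \<sigma>" "lo < \<sigma> ! i" "\<sigma> ! i < hi"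
    using assms(2) unfolding unguarded_def lo_def hi_def by auto
  have between: "lo < \<sigma> ! p" if "i \<le> p" "p < j" for p
  proof (cases "p = i")
    case False
    then have "lo \<le> \<sigma> ! p" "\<sigma> ! p \<noteq> \<sigma> ! j" "\<sigma> ! p \<noteq> \<sigma> ! Suc j"
      using that ij assms unfolding unguarded_def lo_def by (auto simp: nth_eq_iff_index_eq)
    then show ?thesis
      unfolding lo_def by (auto simp: min_def split: if_splits)
  qed (use ij in simp)
  have "?s lo j = ?s lo i"
  proof -
    have "take j \<sigma> = take i \<sigma> @ drop i (take j \<sigma>)"
      using \<open>i < j\<close> by (metis append_take_drop_id min.absorb1 take_take less_imp_le)
    moreover have "\<forall>y\<in>set (drop i (take j \<sigma>)). lo < y"
      using between ij by (auto simp: in_set_conv_nth)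
    ultimately show ?thesis
      using slot_append_larger[of "take i \<sigma>" "drop i (take j \<sigma>)" lo] assms(1)
      by (metis distinct_take)
  qed
  also have "\<dots> \<le> ?s (\<sigma> ! i) i"
    using ij by (intro slot_mono) simp
  also have "\<dots> < ?s hi (Suc i)"
    using assms(1) ij not_hd_pile_configuration_take[of \<sigma> i i]
    by (simp add: pile_configuration_take_Suc slot_less_slot_place_card)
  also have "\<dots> \<le> ?s hi j"
    using assms(1) ij by (intro slot_take_mono) auto
  finally have "?s lo j \<noteq> ?s hi j"
    by simp
  then show ?thesis
    using ij unfolding independent_pair_def lo_def hi_def
    by (auto simp: min_def max_def split: if_splits)
qed

lemma top_was_dealt:
  assumes "distinct \<sigma>" "t \<le> length \<sigma>" "k < length (pile_configuration (take t \<sigma>))"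
  obtains i where "i < t" "hd (pile_configuration (take t \<sigma>) ! k) = \<sigma> ! i"
    "slot (\<sigma> ! i) (pile_configuration (take i \<sigma>)) = k"
proof -
  have "\<exists>i<t. hd (pile_configuration (take t \<sigma>) ! k) = \<sigma> ! i \<and>
      slot (\<sigma> ! i) (pile_configuration (take i \<sigma>)) = k"
    using assms(2,3)
  proof (induction t)
    case (Suc t)
    let ?rs = "pile_configuration (take t \<sigma>)"
    have step: "pile_configuration (take (Suc t) \<sigma>) = place_card (\<sigma> ! t) ?rs"
      using Suc.prems by (simp add: pile_configuration_take_Suc)
    have fresh: "\<sigma> ! t \<notin> hd ` set ?rs"
      using assms(1) Suc.prems by (intro not_hd_pile_configuration_take) auto
    show ?case
    proof (cases "k = slot (\<sigma> ! t) ?rs")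
      case True
      then have "hd (place_card (\<sigma> ! t) ?rs ! k) = \<sigma> ! t"
        by (simp add: place_card_at_slot[OF fresh])
      with True step show ?thesis
        by auto
    next
      case False
      then have "k < length ?rs" "place_card (\<sigma> ! t) ?rs ! k = ?rs ! k"
        using slot_le_length[of "\<sigma> ! t" ?rs] Suc.prems(2) unfolding step
        by (auto simp: place_card_slot[OF fresh] nth_append split: if_splits)
      with Suc step show ?thesis
        by (metis Suc_leD less_Suc_eq)
    qed
  qed simp
  with that show thesis
    by blast
qed

text \<open>
  The entry at \<open>i\<close> is the top of the pile that the smaller card of the pair would join.  It is
  still a top at time \<open>j\<close>, so every smaller card dealt in between went to a pile further left.  The
  predecessor of the first such card is either the entry at \<open>i\<close> itself or a larger card, and
  hence was not dealt further left than that entry.  So the presence of a smaller card would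
  produce an independent pair before \<open>j\<close>.
\<close>

lemma first_independent_pattern:
  assumes "distinct \<sigma>" and pair: "independent_pair \<sigma> j"
    and first: "\<And>m. m < j \<Longrightarrow> \<not> independent_pair \<sigma> m"
  obtains i where "unguarded \<sigma> i j"
proof -
  define lo hi where "lo = min (\<sigma> ! j) (\<sigma> ! Suc j)" and "hi = max (\<sigma> ! j) (\<sigma> ! Suc j)"
  let ?rs = "pile_configuration (take j \<sigma>)"
  let ?s = "\<lambda>c t. slot c (pile_configuration (take t \<sigma>))"
  define k where "k = ?s lo j"
  have len: "Suc j < length \<sigma>"
    using pair by (simp add: independent_pair_def)
  have "?s lo j \<noteq> ?s hi j"
    using pair unfolding independent_pair_def lo_def hi_def by (auto simp: min_def max_def)
  moreover have "?s lo j \<le> ?s hi j"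
    by (rule slot_mono) (simp add: lo_def hi_def)
  ultimately have "k < ?s hi j"
    by (simp add: k_def)
  then have k: "k < length ?rs" and top_hi: "hd (?rs ! k) < hi"
    by (auto dest: top_less_of_less_slot)
  have "\<not> hd (?rs ! k) < lo"
    using k unfolding k_def by (rule top_at_slot)
  moreover have "lo \<notin> hd ` set ?rs"
    using not_hd_pile_configuration_take[OF assms(1), of j] len
    unfolding lo_def by (simp add: min_def)
  ultimately have top_lo: "lo < hd (?rs ! k)"
    using k by (metis image_eqI linorder_neqE_nat nth_mem)
  obtain i where i: "i < j" "hd (?rs ! k) = \<sigma> ! i" "?s (\<sigma> ! i) i = k"
    using top_was_dealt[OF assms(1) _ k] len by auto
  have "lo \<le> \<sigma> ! p" if p: "i < p" "p < j" for p
  proof (rule ccontr)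
    assume "\<not> lo \<le> \<sigma> ! p"
    with p top_lo i(2) have ex: "\<exists>q. i < q \<and> q < j \<and> \<sigma> ! q < \<sigma> ! i"
      by (intro exI[of _ p]) auto
    \<comment> \<open>The first card after \<open>i\<close> that is smaller than the one at \<open>i\<close> makes an independent pair
      with its predecessor.\<close>
    define q where "q = (LEAST q. i < q \<and> q < j \<and> \<sigma> ! q < \<sigma> ! i)"
    have q: "i < q" "q < j" "\<sigma> ! q < \<sigma> ! i"
      using LeastI_ex[OF ex] unfolding q_def by auto
    obtain m where m: "q = Suc m"
      using q(1) by (cases q) auto
    have "\<sigma> ! i \<le> \<sigma> ! m"
    proof (cases "m = i")
      case False
      then have "\<not> \<sigma> ! m < \<sigma> ! i"
        using not_less_Least[of m "\<lambda>q. i < q \<and> q < j \<and> \<sigma> ! q < \<sigma> ! i"] q m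
        unfolding q_def[symmetric] by auto
      then show ?thesis
        by simp
    qed simp
    have "k \<le> ?s (\<sigma> ! i) m"
      using i q m assms(1) slot_take_mono[of \<sigma> i m "\<sigma> ! i"] by simp
    also have "\<dots> \<le> ?s (\<sigma> ! m) m"
      using \<open>\<sigma> ! i \<le> \<sigma> ! m\<close> by (rule slot_mono)
    finally have left: "k \<le> ?s (\<sigma> ! m) m" .
    have "?s (\<sigma> ! q) m \<le> ?s (\<sigma> ! q) q"
      using assms(1) m by (intro slot_take_mono) auto
    also have "\<dots> < ?s (\<sigma> ! i) (Suc q)"
      using assms(1) q len not_hd_pile_configuration_take[of \<sigma> q q]
      by (simp add: pile_configuration_take_Suc slot_less_slot_place_card)
    also have "\<dots> \<le> ?s (\<sigma> ! i) j"
      using assms(1) q by (intro slot_take_mono) auto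
    also have "\<dots> \<le> k"
      using slot_le_of_top[of k ?rs "\<sigma> ! i"] k i(2) by simp
    finally have "?s (\<sigma> ! q) m \<noteq> ?s (\<sigma> ! m) m"
      using left by simp
    then have "independent_pair \<sigma> m"
      using m q len unfolding independent_pair_def by auto
    with first[of m] m q show False
      by simp
  qed
  then have "unguarded \<sigma> i j"
    using i len top_lo top_hi unfolding unguarded_def lo_def hi_def by simp
  then show thesis
    by (rule that)
qed

section \<open>Uniqueness of the preimage\<close>

theorem theorem3p8:
  fixes n :: nat and \<sigma> :: "nat list" and R :: "nat list list"
  assumes "n \<ge> 1"
    and "\<sigma> \<in> permutations_of_set {1..n}"
    and "R = pile_configuration \<sigma>"
  shows "{\<tau> \<in> permutations_of_set {1..n}. pile_configuration \<tau> = R} = {\<sigma>} \<longleftrightarrow>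
         \<sigma> \<in> avoiders n [avoids_3_b1_42, avoids_3_b1_24]"
proof -
  have \<sigma>: "distinct \<sigma>" "set \<sigma> = {1..n}"
    using assms(2) by (auto dest: permutations_of_setD)
  have "\<sigma> \<in> avoiders n [avoids_3_b1_42, avoids_3_b1_24] \<longleftrightarrow> (\<forall>i j. \<not> unguarded \<sigma> i j)"
    using assms(2) avoids_iff_not_unguarded[of \<sigma>] by (simp add: avoiders_def)
  also have "\<dots> \<longleftrightarrow> (\<forall>j. \<not> independent_pair \<sigma> j)"
  proof
    assume none: "\<forall>i j. \<not> unguarded \<sigma> i j"
    have "\<not> independent_pair \<sigma> j" for j
    proof (induction j rule: less_induct)
      case (less j)
      then show ?case
        using first_independent_pattern[OF \<sigma>(1), of j] none by blast
    qed
    then show "\<forall>j. \<not> independent_pair \<sigma> j"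
      by blast
  qed (use pattern_independent[OF \<sigma>(1)] in blast)
  also have "\<dots> \<longleftrightarrow> {\<tau> \<in> permutations_of_set {1..n}. pile_configuration \<tau> = R} = {\<sigma>}"
  proof
    assume "\<forall>j. \<not> independent_pair \<sigma> j"
    then have "\<tau> = \<sigma>" if "\<tau> \<in> permutations_of_set {1..n}" "pile_configuration \<tau> = R" for \<tau>
      using that \<sigma> assms(3) independent_pair_exists[of \<sigma> \<tau>] by (metis permutations_of_setD)
    then show "{\<tau> \<in> permutations_of_set {1..n}. pile_configuration \<tau> = R} = {\<sigma>}"
      using assms(2,3) by auto
  next
    assume unique: "{\<tau> \<in> permutations_of_set {1..n}. pile_configuration \<tau> = R} = {\<sigma>}"
    show "\<forall>j. \<not> independent_pair \<sigma> j"
    proof (intro allI notI)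
      fix j
      assume pair: "independent_pair \<sigma> j"
      then have "Suc j < length \<sigma>"
        by (simp add: independent_pair_def)
      then have split: "\<sigma> = take j \<sigma> @ \<sigma> ! j # \<sigma> ! Suc j # drop (Suc (Suc j)) \<sigma>"
        by (metis Cons_nth_drop_Suc Suc_lessD append_take_drop_id)
      define \<tau> where "\<tau> = take j \<sigma> @ \<sigma> ! Suc j # \<sigma> ! j # drop (Suc (Suc j)) \<sigma>"
      have "pile_configuration \<tau> = R"
        unfolding \<tau>_def assms(3) using pair \<sigma>(1) split
          pile_configuration_swap[of "take j \<sigma>" "\<sigma> ! j" "\<sigma> ! Suc j" "drop (Suc (Suc j)) \<sigma>"]
        by (simp add: independent_pair_def)
      moreover have "mset \<tau> = mset \<sigma>"
        by (subst split) (simp add: \<tau>_def)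
      then have "\<tau> \<in> permutations_of_set {1..n}"
        using \<sigma> by (metis mset_eq_imp_distinct_iff mset_eq_setD permutations_of_setI)
      ultimately have "\<tau> = \<sigma>"
        using unique by blast
      then have "\<sigma> ! j = \<sigma> ! Suc j"
        using split unfolding \<tau>_def by (metis append_same_eq list.inject same_append_eq)
      with \<sigma>(1) \<open>Suc j < length \<sigma>\<close> show False
        by (simp add: nth_eq_iff_index_eq)
    qed
  qed
  finally show ?thesis
    by blast
qed

end
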